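(* $G$ is a connected well-hued graph with sequence $(2,4,6,\dots,2k,2k+1,\dots,n(G))$, where $n(G)\ge 3k$ and $k\ge 2$, if and only if $G$ is obtained from a clique $G_1=K_{n(G)-k}$ and a graph $G_2$ of order $k$ where the following are true: (1) for any $u\in V(G)$, the graph induced by $V(G)-N_G[u]$ is a clique, and (2) for any set of $k$ vertices in $G_1$, say $X_k$, there exists a perfect matching between $X_k$ and $V(G_2)$ in $\overline{G}$.
   Context: All graphs are finite and simple, and $n(G)=|V(G)|$. For $j\ge 1$, a maximal $j$-colorable subgraph of $G$ is a subgraph induced by a set $S\subseteq V(G)$ such that $G[S]$ is (properly) $j$-colorable and $G[S']$ is not $j$-colorable for every $S'$ with $S\subsetneq S'\subseteq V(G)$. $G$ is well-hued if for every $j\ge 1$ all maximal $j$-colorable subgraphs of $G$ have the same order, denoted $a_j$. The sequence of a well-hued graph $G$ is written $(a_1,a_2,\dots,a_{\chi(G)})$, where $\chi(G)$ is the chromatic number and $a_{\chi(G)}=n(G)$. The sequence $(2,4,6,\dots,2k,2k+1,\dots,n(G))$ means $a_i=2i$ for $1\le i\le k$ and $a_i=k+i$ for $k\le i\le n(G)-k$. "$G$ is obtained from $G_1$ and $G_2$" means that $V(G)$ is partitioned into two sets inducing $G_1$ and $G_2$, with edges between the two sets restricted only by (1) and (2). $\overline{G}$ is the complement of $G$, and $N_G[u]$ is the closed neighborhood of $u$. A perfect matching between $X_k$ and $V(G_2)$ in $\overline{G}$ is a set of $k$ pairwise disjoint edges of $\overline{G}$, each joining a vertex of $X_k$ to a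 vertex of $G_2$.
   Formalization: G is assumed connected on both sides of the equivalence: the disjoint union of K_{n(G)-k} and K_k satisfies (1) and (2) but is disconnected, so the literal converse fails. The conditions n(G) ≥ 3k and k ≥ 2 are assumed for both directions. *)

theory Defs
  imports "Graph_Theory.Graph_Theory"
begin

text \<open>
  A finite simple graph is an element of the locale \<open>graph\<close>: a finite symmetric digraph without
  loops and multiple arcs. An undirected edge is a pair of opposite arcs, and two vertices \<open>u\<close> and
  \<open>v\<close> are adjacent iff \<open>(u, v) \<in> arcs_ends G\<close>.
\<close>

definition colorable :: "('a, 'b) pre_digraph \<Rightarrow> nat \<Rightarrow> bool" where
  "colorable G j \<longleftrightarrow>
     (\<exists>c :: 'a \<Rightarrow> nat. c ` verts G \<subseteq> {..<j} \<and> (\<forall>(u, v) \<in> arcs_ends G. c u \<noteq> c v))"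

definition chromatic_number :: "('a, 'b) pre_digraph \<Rightarrow> nat" where
  "chromatic_number G = (LEAST j. colorable G j)"

definition maximal_colorable :: "('a, 'b) pre_digraph \<Rightarrow> nat \<Rightarrow> 'a set \<Rightarrow> bool" where
  "maximal_colorable G j S \<longleftrightarrow>
     S \<subseteq> verts G \<and> colorable (G \<restriction> S) j \<and>
     (\<forall>S'. S \<subset> S' \<and> S' \<subseteq> verts G \<longrightarrow> \<not> colorable (G \<restriction> S') j)"

definition well_hued :: "('a, 'b) pre_digraph \<Rightarrow> bool" where
  "well_hued G \<longleftrightarrow>
     (\<forall>j\<ge>1. \<forall>S T. maximal_colorable G j S \<and> maximal_colorable G j T \<longrightarrow> card S = card T)"

text \<open>
  The number \<open>a\<^sub>j\<close>. The description is proper when \<open>G\<close> is finite and well-hued and \<open>j \<ge> 1\<close>; it is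
  unspecified for graphs that are not well-hued.
\<close>

definition hue_order :: "('a, 'b) pre_digraph \<Rightarrow> nat \<Rightarrow> nat" where
  "hue_order G j = (THE m. \<exists>S. maximal_colorable G j S \<and> card S = m)"

definition hue_sequence :: "('a, 'b) pre_digraph \<Rightarrow> nat list" where
  "hue_sequence G = map (hue_order G) [1..<chromatic_number G + 1]"

text \<open>The sequence \<open>(2, 4, 6, \<dots>, 2k, 2k + 1, \<dots>, n)\<close>, which has \<open>n - k\<close> entries when \<open>n \<ge> 2k\<close>.\<close>

definition even_then_consecutive :: "nat \<Rightarrow> nat \<Rightarrow> nat list" where
  "even_then_consecutive k n = map (\<lambda>i. if i \<le> k then 2 * i else k + i) [1..<n - k + 1]"

definition closed_neighborhood :: "('a, 'b) pre_digraph \<Rightarrow> 'a \<Rightarrow> 'a set" where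
  "closed_neighborhood G u = insert u {v. (u, v) \<in> arcs_ends G}"

definition is_clique :: "('a, 'b) pre_digraph \<Rightarrow> bool" where
  "is_clique H \<longleftrightarrow> complete_digraph (card (verts H)) H"

definition graph_complement :: "('a, 'b) pre_digraph \<Rightarrow> 'a pair_pre_digraph" where
  "graph_complement G =
     \<lparr>pverts = verts G,
      parcs = {(u, v). u \<in> verts G \<and> v \<in> verts G \<and> u \<noteq> v \<and> (u, v) \<notin> arcs_ends G}\<rparr>"

text \<open>
  For disjoint \<open>X\<close> and \<open>Y\<close>, an undirected edge joining \<open>X\<close> and \<open>Y\<close> is represented by its unique
  orientation from \<open>X\<close> to \<open>Y\<close>, so that \<open>card M\<close> counts undirected edges.
\<close>

definition matching_between ::
    "('a, 'b) pre_digraph \<Rightarrow> 'a set \<Rightarrow> 'a set \<Rightarrow> ('a \<times> 'a) set \<Rightarrow> bool" where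
  "matching_between H X Y M \<longleftrightarrow>
     M \<subseteq> arcs_ends H \<inter> (X \<times> Y) \<and>
     (\<forall>e\<in>M. \<forall>f\<in>M. e \<noteq> f \<longrightarrow> {fst e, snd e} \<inter> {fst f, snd f} = {})"

end

theory Submission
  imports Defs
begin

text \<open>
  Work in the complement \<open>H\<close> of \<open>G\<close>. When \<open>G\<close> has no independent triple, a set \<open>S\<close> is
  \<open>j\<close>-colorable iff \<open>H[S]\<close> has a matching with at least \<open>|S| - j\<close> edges.

  Given the sequence, \<open>H\<close> has matching number \<open>k\<close>, and a clique of order \<open>k\<close> extends to a
  \<open>k\<close>-colorable set of order \<open>2k\<close>, so it is matched by \<open>k\<close> edges of \<open>H\<close>. Apply this to a clique \<open>W\<close> of
  \<open>k\<close> vertices missed by a maximum matching: by the absence of augmenting paths, \<open>W\<close> is matched to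
  exactly one endpoint of each matching edge. These endpoints form \<open>V(G\<^sub>2)\<close>, and again by the
  absence of augmenting paths all remaining vertices form a clique.

  Conversely, (2) bounds by \<open>k - 1\<close> the number of neighbors in \<open>G\<^sub>1\<close> of a vertex of \<open>G\<^sub>2\<close>, so (1) and
  \<open>n \<ge> 3k\<close> make \<open>G\<^sub>2\<close> a clique. Let \<open>S\<close> be maximal \<open>j\<close>-colorable with \<open>X = S \<inter> V(G\<^sub>1)\<close> and
  \<open>T = S \<inter> V(G\<^sub>2)\<close>. For \<open>j \<ge> k\<close> one can add all of \<open>V(G\<^sub>2)\<close> and enlarge \<open>X\<close> to order \<open>j\<close>. For \<open>j < k\<close>
  each vertex of \<open>T\<close> shares its color with a vertex of \<open>X\<close>, for otherwise one of its many
  non-neighbors in \<open>G\<^sub>1\<close> could be added to its class; then \<open>X\<close> has a matching in \<open>H\<close> into \<open>V(G\<^sub>2)\<close> that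
  covers \<open>T\<close>, and maximality forces \<open>|S| = 2|X| = 2j\<close>.
\<close>

text \<open>
  The Mendelsohn--Dulmage theorem for bipartite matchings. Redirecting \<open>N\<close> at \<open>M t\<close> to an uncovered
  \<open>t\<close> never spoils an agreement of \<open>N\<close> with \<open>M\<close>, so the process ends.
\<close>

lemma injection_covering_both_sides:
  assumes "finite T" "inj_on N X" "\<And>x. x \<in> X \<Longrightarrow> R x (N x)"
    and "inj_on M T" "M ` T \<subseteq> X" "\<And>t. t \<in> T \<Longrightarrow> R (M t) t"
  shows "\<exists>N'. inj_on N' X \<and> T \<subseteq> N' ` X \<and> N' ` X \<subseteq> N ` X \<union> T \<and> (\<forall>x\<in>X. R x (N' x))"
  using assms(2,3)
proof (induction "card {t \<in> T. N (M t) \<noteq> t}" arbitrary: N rule: less_induct)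
  case less
  show ?case
  proof (cases "T \<subseteq> N ` X")
    case True
    with less.prems show ?thesis by blast
  next
    case False
    then obtain t where t: "t \<in> T" "t \<notin> N ` X" by blast
    define N2 where "N2 = N(M t := t)"
    have mt: "M t \<in> X" using t assms(5) by auto
    have inj: "inj_on N2 X"
      using less.prems(1) t(2) by (auto simp: N2_def inj_on_def)
    have R: "R x (N2 x)" if "x \<in> X" for x
      using that less.prems(2) assms(6)[OF t(1)] by (auto simp: N2_def)
    have smaller: "card {s \<in> T. N2 (M s) \<noteq> s} < card {s \<in> T. N (M s) \<noteq> s}"
    proof (rule psubset_card_mono)
      show "finite {s \<in> T. N (M s) \<noteq> s}" using assms(1) by simp
      have "M s \<noteq> M t" if "s \<in> T" "s \<noteq> t" for s
        using that t(1) assms(4) by (auto simp: inj_on_def)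
      then have "N (M s) \<noteq> s" if "s \<in> T" "N2 (M s) \<noteq> s" for s
        using that by (cases "s = t") (simp_all add: N2_def)
      moreover have "t \<in> {s \<in> T. N (M s) \<noteq> s}"
        using t mt by (metis (mono_tags) imageI mem_Collect_eq)
      moreover have "t \<notin> {s \<in> T. N2 (M s) \<noteq> s}" by (simp add: N2_def)
      ultimately show "{s \<in> T. N2 (M s) \<noteq> s} \<subset> {s \<in> T. N (M s) \<noteq> s}"
        by (metis (mono_tags, lifting) mem_Collect_eq psubsetI subsetI)
    qed
    have "\<exists>N'. inj_on N' X \<and> T \<subseteq> N' ` X \<and> N' ` X \<subseteq> N2 ` X \<union> T \<and> (\<forall>x\<in>X. R x (N' x))"
      using less.hyps[OF smaller inj R] .
    moreover have "N2 ` X \<subseteq> N ` X \<union> T" 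
    proof
      fix y assume "y \<in> N2 ` X"
      then obtain x where "x \<in> X" "y = N2 x" by blast
      then show "y \<in> N ` X \<union> T"
        using t(1) by (cases "x = M t") (simp_all add: N2_def)
    qed
    ultimately show ?thesis by (meson subset_trans sup_least sup_ge2)
  qed
qed

section \<open>Colorability and matchings of the complement\<close>

definition nonadjacent :: "('a, 'b) pre_digraph \<Rightarrow> 'a \<Rightarrow> 'a \<Rightarrow> bool" where
  "nonadjacent G u v \<longleftrightarrow> u \<noteq> v \<and> (u, v) \<notin> arcs_ends G"

definition clique_in :: "('a, 'b) pre_digraph \<Rightarrow> 'a set \<Rightarrow> bool" where
  "clique_in G S \<longleftrightarrow> S \<subseteq> verts G \<and> (\<forall>u\<in>S. \<forall>v\<in>S. \<not> nonadjacent G u v)"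

text \<open>The independence number is at most 2. This is the form in which condition (1) is
  used.\<close>

definition independent_triple_free :: "('a, 'b) pre_digraph \<Rightarrow> bool" where
  "independent_triple_free G \<longleftrightarrow>
     (\<forall>x\<in>verts G. \<forall>y\<in>verts G. \<forall>z\<in>verts G.
        \<not> (nonadjacent G x y \<and> nonadjacent G y z \<and> nonadjacent G x z))"

text \<open>A matching of the complement of \<open>G[S]\<close>, with its edges oriented from \<open>A\<close> to \<open>f ` A\<close>.\<close>

definition comatching :: "('a, 'b) pre_digraph \<Rightarrow> 'a set \<Rightarrow> ('a \<Rightarrow> 'a) \<Rightarrow> 'a set \<Rightarrow> bool" where
  "comatching G S f A \<longleftrightarrow>
     A \<subseteq> S \<and> f ` A \<subseteq> S \<and> inj_on f A \<and> A \<inter> f ` A = {} \<and> (\<forall>a\<in>A. nonadjacent G a (f a))"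

lemma arcs_ends_induce: "arcs_ends (G \<restriction> S) = arcs_ends G \<inter> S \<times> S"
  by (auto simp: arcs_ends_conv)

lemma clique_in_subset: "clique_in G S \<Longrightarrow> T \<subseteq> S \<Longrightarrow> clique_in G T"
  by (auto simp: clique_in_def)

lemma colorable_mono: "colorable G i \<Longrightarrow> i \<le> j \<Longrightarrow> colorable G j"
  unfolding colorable_def by (meson lessThan_subset_iff subset_trans)

context graph
begin

lemma nonadjacent_sym: "nonadjacent G u v \<Longrightarrow> nonadjacent G v u"
  using graph_symmetric by (auto simp: nonadjacent_def)

lemma arcs_ends_not_nonadjacent: "(u, v) \<in> arcs_ends G \<longleftrightarrow> u \<noteq> v \<and> \<not> nonadjacent G u v"
  using adj_not_same by (auto simp: nonadjacent_def)

lemma colorable_induce_iff: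
  "colorable (G \<restriction> S) j \<longleftrightarrow>
     (\<exists>c. c ` S \<subseteq> {..<j} \<and> (\<forall>u\<in>S. \<forall>v\<in>S. u \<noteq> v \<and> c u = c v \<longrightarrow> nonadjacent G u v))"
proof -
  have "(\<forall>(u, v)\<in>arcs_ends (G \<restriction> S). c u \<noteq> c v) \<longleftrightarrow>
      (\<forall>u\<in>S. \<forall>v\<in>S. u \<noteq> v \<and> c u = c v \<longrightarrow> nonadjacent G u v)" for c :: "'a \<Rightarrow> nat"
    using arcs_ends_not_nonadjacent unfolding arcs_ends_induce by blast
  then show ?thesis by (simp add: colorable_def)
qed

lemma colorable_induce_verts: "colorable (G \<restriction> verts G) j = colorable G j"
proof -
  have "arcs_ends (G \<restriction> verts G) = arcs_ends G"
    by (auto simp: arcs_ends_conv)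
  then show ?thesis by (simp add: colorable_def)
qed

lemma finite_subset_verts: "S \<subseteq> verts G \<Longrightarrow> finite S"
  using finite_subset finite_verts by blast

text \<open>The two ends of each matching edge share a color and every other vertex gets its own, so
  each edge saves one color.\<close>

lemma colorable_comatching:
  assumes "S \<subseteq> verts G" "comatching G S f A"
  shows "colorable (G \<restriction> S) (card S - card A)"
proof -
  have fin: "finite S" using assms(1) by (rule finite_subset_verts)
  have m: "A \<subseteq> S" "f ` A \<subseteq> S" "inj_on f A" "A \<inter> f ` A = {}" "\<And>a. a \<in> A \<Longrightarrow> nonadjacent G a (f a)"
    using assms(2) by (auto simp: comatching_def)
  \<comment> \<open>\<open>r\<close> moves the second end of an edge to its first end and fixes all
    other vertices; the color of \<open>v\<close> is the number that \<open>g\<close> assigns to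
    \<open>r v\<close>.\<close>
  define r where "r v = (if v \<in> f ` A then inv_into A f v else v)" for v
  have r: "r ` S \<subseteq> S - f ` A"
  proof
    fix w assume "w \<in> r ` S"
    then obtain v where "v \<in> S" "w = r v" by auto
    then show "w \<in> S - f ` A"
      using m(1,4) inv_into_into[of v f A] by (auto simp: r_def)
  qed
  have "card (S - f ` A) = card S - card A"
    using m by (simp add: card_Diff_subset card_image finite_subset[OF m(1) fin])
  then obtain g where g: "bij_betw g (S - f ` A) {..<card S - card A}"
    using fin by (metis atLeast0LessThan ex_bij_betw_finite_nat finite_Diff)
  have "nonadjacent G u v" if uv: "u \<in> S" "v \<in> S" "u \<noteq> v" "g (r u) = g (r v)" for u v
  proof -
    have "r u \<in> S - f ` A" "r v \<in> S - f ` A" using r uv by auto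
    then have "r u = r v" using g uv(4) by (auto simp: bij_betw_def inj_on_def)
    then have "u \<in> f ` A \<and> v = inv_into A f u \<or> v \<in> f ` A \<and> u = inv_into A f v"
      using uv(3) inv_into_injective[of A f u v]
      by (cases "u \<in> f ` A"; cases "v \<in> f ` A") (simp_all add: r_def)
    then consider "u \<in> f ` A" "v = inv_into A f u" | "v \<in> f ` A" "u = inv_into A f v" by blast
    then show ?thesis
    proof cases
      case 1
      then show ?thesis
        using m(5)[OF inv_into_into[OF 1(1)]] f_inv_into_f[OF 1(1)] nonadjacent_sym by simp
    next
      case 2
      then show ?thesis
        using m(5)[OF inv_into_into[OF 2(1)]] f_inv_into_f[OF 2(1)] by simp
    qed
  qed
  moreover have "(\<lambda>v. g (r v)) ` S \<subseteq> {..<card S - card A}"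
    using g image_mono[OF r, of g] by (simp add: bij_betw_def image_image)
  ultimately show ?thesis
    unfolding colorable_induce_iff by (intro exI[of _ "\<lambda>v. g (r v)"]) auto
qed

text \<open>Color classes have at most two vertices. Each class has a representative, and a vertex
  that is not one is matched to the representative of its class; there are at most \<open>j\<close>
  representatives.\<close>

lemma comatching_of_colorable:
  assumes "independent_triple_free G" "S \<subseteq> verts G" "colorable (G \<restriction> S) j"
  shows "\<exists>f A. comatching G S f A \<and> card S \<le> card A + j"
proof -
  have fin: "finite S" using assms(2) by (rule finite_subset_verts)
  obtain c where c: "c ` S \<subseteq> {..<j}"
    "\<And>u v. u \<in> S \<Longrightarrow> v \<in> S \<Longrightarrow> u \<noteq> v \<Longrightarrow> c u = c v \<Longrightarrow> nonadjacent G u v"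
    using assms(3) unfolding colorable_induce_iff by blast
  define r where "r = inv_into S c"
  define R where "R = r ` c ` S"
  have r: "r (c v) \<in> R" "r (c v) \<in> S" "c (r (c v)) = c v" if "v \<in> S" for v
    using that by (auto simp: r_def R_def inv_into_into f_inv_into_f)
  have R: "R \<subseteq> S" using r by (auto simp: R_def)
  have ne: "v \<noteq> r (c v)" if "v \<in> S - R" for v using r(1)[of v] that by auto
  \<comment> \<open>Two vertices matched to the same representative would form an independent triple
    with it.\<close>
  have "inj_on (\<lambda>v. r (c v)) (S - R)"
  proof (rule inj_onI, rule ccontr)
    fix u v assume uv: "u \<in> S - R" "v \<in> S - R" "r (c u) = r (c v)" "u \<noteq> v"
    then have "c u = c v" using r(3) by (metis DiffD1)
    then have "nonadjacent G u v" "nonadjacent G v (r (c u))" "nonadjacent G u (r (c u))"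
      using uv ne r by (auto intro!: c(2))
    moreover have "u \<in> verts G" "v \<in> verts G" "r (c u) \<in> verts G"
      using uv r(2)[of u] assms(2) by auto
    ultimately show False
      using assms(1) unfolding independent_triple_free_def by blast
  qed
  then have "comatching G S (\<lambda>v. r (c v)) (S - R)"
    using r ne by (auto simp: comatching_def intro!: c(2))
  moreover have "card S \<le> card (S - R) + j"
  proof -
    have "card R \<le> j"
      using c(1) card_image_le[of "c ` S" r] card_mono[OF _ c(1)] fin by (auto simp: R_def)
    then show ?thesis
      using R fin by (simp add: card_Diff_subset finite_subset)
  qed
  ultimately show ?thesis by blast
qed

lemma clique_inj_on_coloring:
  assumes "clique_in G X" "\<And>u v. u \<in> X \<Longrightarrow> v \<in> X \<Longrightarrow> u \<noteq> v \<Longrightarrow> c u = c v \<Longrightarrow> nonadjacent G u v"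
  shows "inj_on c X"
  using assms by (auto simp: inj_on_def clique_in_def)

lemma clique_card_le:
  assumes "clique_in G X" "X \<subseteq> S" "colorable (G \<restriction> S) j"
  shows "card X \<le> j"
proof -
  obtain c where c: "c ` S \<subseteq> {..<j}"
    "\<And>u v. u \<in> S \<Longrightarrow> v \<in> S \<Longrightarrow> u \<noteq> v \<Longrightarrow> c u = c v \<Longrightarrow> nonadjacent G u v"
    using assms(3) unfolding colorable_induce_iff by blast
  have "inj_on c X"
    using assms c(2) by (intro clique_inj_on_coloring) auto
  then show ?thesis
    using c(1) assms(2) card_inj_on_le[of c X "{..<j}"] by auto
qed

lemma colorable_card:
  assumes "S \<subseteq> verts G"
  shows "colorable (G \<restriction> S) (card S)"
  using colorable_comatching[OF assms, of id "{}"] by (simp add: comatching_def)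

lemma extend_to_maximal_colorable:
  assumes "S \<subseteq> verts G" "colorable (G \<restriction> S) j"
  shows "\<exists>S'. S \<subseteq> S' \<and> maximal_colorable G j S'"
proof -
  have "finite {S'. S' \<subseteq> verts G \<and> colorable (G \<restriction> S') j}" by simp
  then obtain S' where "S \<subseteq> S'" "S' \<subseteq> verts G" "colorable (G \<restriction> S') j"
    "\<forall>T. T \<subseteq> verts G \<and> colorable (G \<restriction> T) j \<longrightarrow> S' \<subseteq> T \<longrightarrow> S' = T"
    using finite_has_maximal2[of "{S'. S' \<subseteq> verts G \<and> colorable (G \<restriction> S') j}" S] assms by auto
  then show ?thesis
    unfolding maximal_colorable_def by (intro exI[of _ S']) blast
qed

lemma ex_maximal_colorable: "\<exists>S. maximal_colorable G j S"
  using extend_to_maximal_colorable[of "{}" j] by (auto simp: colorable_induce_iff)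

lemma maximal_colorableD:
  assumes "maximal_colorable G j S" "S \<subseteq> T" "T \<subseteq> verts G" "colorable (G \<restriction> T) j"
  shows "T = S"
  using assms unfolding maximal_colorable_def by blast

text \<open>Some maximal \<open>j\<close>-colorable set exists, so a common order of all of them
  determines the description in \<open>hue_order\<close>.\<close>

lemma hue_order_eqI:
  assumes "\<And>S. maximal_colorable G j S \<Longrightarrow> card S = m"
  shows "hue_order G j = m"
  unfolding hue_order_def using assms ex_maximal_colorable[of j] by (intro the_equality) auto

section \<open>Cliques and perfect matchings as the theorem states them\<close>

lemma complete_induce_iff:
  assumes "S \<subseteq> verts G"
  shows "complete_digraph m (G \<restriction> S) \<longleftrightarrow> card S = m \<and> clique_in G S"
proof -
  interpret GS: wf_digraph "G \<restriction> S" by (rule wellformed_induce_subgraph)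
  \<comment> \<open>\<open>complete_digraph\<close> includes the predicate \<open>graph\<close>, so
    the induced digraph must itself be shown to be finite, simple and symmetric.\<close>
  have "graph (G \<restriction> S)"
  proof unfold_locales
    show "finite (verts (G \<restriction> S))" using finite_subset_verts[OF assms] by simp
    show "finite (arcs (G \<restriction> S))" by simp
    show "tail (G \<restriction> S) e \<noteq> head (G \<restriction> S) e" if "e \<in> arcs (G \<restriction> S)" for e
      using that no_loops by auto
    show "e1 = e2" if "e1 \<in> arcs (G \<restriction> S)" "e2 \<in> arcs (G \<restriction> S)"
      "arc_to_ends (G \<restriction> S) e1 = arc_to_ends (G \<restriction> S) e2" for e1 e2
      using that no_multi_arcs by auto
    show "symmetric (G \<restriction> S)"
      using graph_symmetric by (auto simp: symmetric_def sym_def arcs_ends_induce)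
  qed
  moreover have "arcs_ends (G \<restriction> S) = {(u, v). u \<in> S \<and> v \<in> S \<and> u \<noteq> v \<and> \<not> nonadjacent G u v}"
    by (auto simp: arcs_ends_induce arcs_ends_not_nonadjacent)
  then have "arcs_ends (G \<restriction> S) = {(u, v). (u, v) \<in> S \<times> S \<and> u \<noteq> v} \<longleftrightarrow> clique_in G S"
    using assms by (auto simp: clique_in_def set_eq_iff nonadjacent_def)
  ultimately show ?thesis
    by (auto simp: complete_digraph_def)
qed

text \<open>Outside the closed neighborhood of \<open>u\<close> lie exactly the vertices nonadjacent
  to \<open>u\<close>; two nonadjacent ones among them complete an independent triple with
  \<open>u\<close>.\<close>

lemma nonneighbors_cliques_iff:
  "(\<forall>u\<in>verts G. is_clique (G \<restriction> (verts G - closed_neighborhood G u))) \<longleftrightarrow>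
     independent_triple_free G"
proof -
  have "verts G - closed_neighborhood G u = {v \<in> verts G. nonadjacent G u v}" for u
    by (auto simp: closed_neighborhood_def nonadjacent_def)
  then have "(\<forall>u\<in>verts G. is_clique (G \<restriction> (verts G - closed_neighborhood G u))) \<longleftrightarrow>
      (\<forall>u\<in>verts G. clique_in G {v \<in> verts G. nonadjacent G u v})"
    by (simp add: is_clique_def complete_induce_iff)
  then show ?thesis
    by (auto simp: clique_in_def independent_triple_free_def)
qed

text \<open>A matching of \<open>k\<close> edges between two sets of order \<open>k\<close>
  saturates both, hence is the graph of a bijection.\<close>

lemma matching_between_complement_iff:
  assumes "X \<inter> Y = {}" "X \<subseteq> verts G" "Y \<subseteq> verts G" "card X = k" "card Y = k"
  shows "(\<exists>M. matching_between (graph_complement G) X Y M \<and> card M = k) \<longleftrightarrow>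
     (\<exists>f. inj_on f X \<and> f ` X = Y \<and> (\<forall>x\<in>X. nonadjacent G x (f x)))"
proof
  assume "\<exists>M. matching_between (graph_complement G) X Y M \<and> card M = k"
  then obtain M where match: "matching_between (graph_complement G) X Y M" and "card M = k" by blast
  then have M: "M \<subseteq> X \<times> Y"
    "\<forall>e\<in>M. \<forall>f\<in>M. e \<noteq> f \<longrightarrow> {fst e, snd e} \<inter> {fst f, snd f} = {}" "card M = k"
    by (simp_all add: matching_between_def)
  have nonadj: "nonadjacent G u v" if "(u, v) \<in> M" for u v
    using match that by (auto simp: matching_between_def graph_complement_def nonadjacent_def)
  have fin: "finite X" "finite Y" using assms finite_subset_verts by auto
  have i: "inj_on fst M" "inj_on snd M"
    using M(2) by (auto simp: inj_on_def; blast)+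
  \<comment> \<open>Disjoint edges have distinct first ends, and \<open>k\<close> of them exhaust
    \<open>X\<close>; likewise for the second ends and \<open>Y\<close>.\<close>
  have "fst ` M = X"
    using M i fin assms by (intro card_subset_eq) (auto simp: card_image)
  moreover have "snd ` M = Y"
    using M i fin assms by (intro card_subset_eq) (auto simp: card_image)
  ultimately have X: "fst ` M = X" and Y: "snd ` M = Y" by auto
  define f where "f = snd \<circ> inv_into M fst"
  have f: "f (fst e) = snd e" if "e \<in> M" for e
    using that i(1) by (simp add: f_def)
  have "inj_on f X"
    using i(2) unfolding X[symmetric] by (auto simp: inj_on_def f)
  moreover have "f ` X = Y"
    unfolding X[symmetric] Y[symmetric] image_image using f by simp
  moreover have "nonadjacent G x (f x)" if "x \<in> X" for x
  proof -
    obtain e where "e \<in> M" "fst e = x" using X \<open>x \<in> X\<close> by auto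
    then show ?thesis using nonadj[of x "snd e"] f[of e] by auto
  qed
  ultimately show "\<exists>f. inj_on f X \<and> f ` X = Y \<and> (\<forall>x\<in>X. nonadjacent G x (f x))" by blast
next
  assume "\<exists>f. inj_on f X \<and> f ` X = Y \<and> (\<forall>x\<in>X. nonadjacent G x (f x))"
  then obtain f where f: "inj_on f X" "f ` X = Y" "\<And>x. x \<in> X \<Longrightarrow> nonadjacent G x (f x)" by blast
  let ?M = "(\<lambda>x. (x, f x)) ` X"
  have "matching_between (graph_complement G) X Y ?M"
    unfolding matching_between_def
  proof (intro conjI ballI impI)
    show "?M \<subseteq> arcs_ends (graph_complement G) \<inter> X \<times> Y"
      using f assms by (auto simp: graph_complement_def nonadjacent_def)
    show "{fst e, snd e} \<inter> {fst e', snd e'} = {}" if "e \<in> ?M" "e' \<in> ?M" "e \<noteq> e'" for e e'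
    proof -
      obtain x x' where x: "x \<in> X" "x' \<in> X" "e = (x, f x)" "e' = (x', f x')"
        using \<open>e \<in> ?M\<close> \<open>e' \<in> ?M\<close> by blast
      have "f x \<in> Y" "f x' \<in> Y" "f x \<noteq> f x'" "x \<noteq> x'"
        using x f(1,2) \<open>e \<noteq> e'\<close> by (auto simp: inj_on_def)
      then show ?thesis using x assms(1) by auto
    qed
  qed
  moreover have "card ?M = k" using assms(4) by (simp add: card_image inj_on_def)
  ultimately show "\<exists>M. matching_between (graph_complement G) X Y M \<and> card M = k" by blast
qed

end

section \<open>From the clique structure to the sequence\<close>

text \<open>Condition (1) enters as \<open>triple_free\<close> and condition (2) as
  \<open>ex_matching\<close>, with each perfect matching given as a bijection. That
  \<open>V2\<close> is a clique is derived.\<close>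

locale matched_cliques = graph G for G :: "('a, 'b) pre_digraph" (structure) +
  fixes V1 V2 :: "'a set" and k :: nat
  assumes partition: "V1 \<union> V2 = verts G" "V1 \<inter> V2 = {}"
    and V1_clique: "clique_in G V1"
    and card_V2: "card V2 = k"
    and triple_free: "independent_triple_free G"
    and ex_matching: "X \<subseteq> V1 \<Longrightarrow> card X = k \<Longrightarrow>
      \<exists>f. inj_on f X \<and> f ` X = V2 \<and> (\<forall>x\<in>X. nonadjacent G x (f x))"
    and large: "3 * k \<le> card (verts G)"
begin

lemma finite_V1: "finite V1" and finite_V2: "finite V2"
  using partition(1) finite_verts by (metis finite_Un)+

lemma card_V1: "card V1 = card (verts G) - k"
  using partition card_V2 finite_V1 finite_V2 card_Un_disjoint by (metis add_diff_cancel_right')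

text \<open>A set of \<open>k\<close> neighbors of \<open>t\<close> would be perfectly matched onto
  \<open>V2\<close>, leaving no admissible partner for \<open>t\<close>.\<close>

lemma few_neighbors_in_V1:
  assumes "t \<in> V2"
  shows "card {x \<in> V1. \<not> nonadjacent G x t} < k"
proof (rule ccontr)
  assume "\<not> ?thesis"
  then have "k \<le> card {x \<in> V1. \<not> nonadjacent G x t}" by simp
  then obtain X where X: "X \<subseteq> {x \<in> V1. \<not> nonadjacent G x t}" "card X = k" "finite X"
    by (rule obtain_subset_with_card_n)
  then obtain f where "f ` X = V2" "\<forall>x\<in>X. nonadjacent G x (f x)"
    using ex_matching[of X] by blast
  then show False using X(1) assms by blast
qed

text \<open>Two nonadjacent vertices of \<open>V2\<close> together have fewer than 2k neighbors in
  \<open>V1\<close>, which has at least 2k vertices; a vertex of \<open>V1\<close> missed by both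
  completes an independent triple.\<close>

lemma V2_clique: "clique_in G V2"
proof -
  have "\<not> nonadjacent G s t" if st: "s \<in> V2" "t \<in> V2" for s t
  proof
    assume nonadj: "nonadjacent G s t"
    let ?N = "\<lambda>t. {x \<in> V1. \<not> nonadjacent G x t}"
    have "card (?N s \<union> ?N t) < card V1"
      using card_Un_le[of "?N s" "?N t"] few_neighbors_in_V1[OF st(1)] few_neighbors_in_V1[OF st(2)]
        card_V1 large by linarith
    then have "?N s \<union> ?N t \<noteq> V1" by (metis less_irrefl)
    then obtain x where x: "x \<in> V1" "nonadjacent G x s" "nonadjacent G x t" by blast
    have "x \<in> verts G" "s \<in> verts G" "t \<in> verts G" using x st partition(1) by auto
    then show False
      using x nonadj triple_free unfolding independent_triple_free_def by blast
  qed
  then show ?thesis using partition(1) by (auto simp: clique_in_def)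
qed

text \<open>Matching \<open>k\<close> vertices of \<open>X\<close> onto \<open>V2\<close> lets all
  of \<open>V2\<close> reuse colors of \<open>X\<close>.\<close>

lemma colorable_with_V2:
  assumes "X \<subseteq> V1" "k \<le> card X"
  shows "colorable (G \<restriction> (X \<union> V2)) (card X)"
proof -
  obtain Y where Y: "Y \<subseteq> X" "card Y = k" "finite Y"
    using assms(2) by (rule obtain_subset_with_card_n)
  have "Y \<subseteq> V1" using Y(1) assms(1) by blast
  then obtain f where f: "inj_on f Y" "f ` Y = V2" "\<forall>x\<in>Y. nonadjacent G x (f x)"
    using ex_matching[of Y] Y(2) by blast
  moreover have "Y \<inter> V2 = {}" using \<open>Y \<subseteq> V1\<close> partition(2) by blast
  ultimately have "comatching G (X \<union> V2) f Y"
    using Y(1) by (simp add: comatching_def le_supI1)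
  moreover have "X \<union> V2 \<subseteq> verts G" using assms(1) partition(1) by blast
  moreover have "card (X \<union> V2) = card X + k"
    using assms(1) partition(2) card_V2 finite_V1 finite_V2
    by (subst card_Un_disjoint) (auto intro: finite_subset)
  ultimately show ?thesis
    using colorable_comatching[of "X \<union> V2" f Y] Y(2) by simp
qed

lemma colorable_iff: "colorable G j \<longleftrightarrow> card (verts G) - k \<le> j"
proof
  assume "colorable G j"
  then show "card (verts G) - k \<le> j"
    using clique_card_le[OF V1_clique, of "verts G" j] partition(1) card_V1 colorable_induce_verts
    by auto
next
  have "k \<le> card V1" using card_V1 large by linarith
  then have "colorable G (card V1)"
    using colorable_with_V2[of V1] partition(1) colorable_induce_verts by simp
  then show "card (verts G) - k \<le> j \<Longrightarrow> colorable G j"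
    using card_V1 colorable_mono by metis
qed

lemma chromatic_number_eq: "chromatic_number G = card (verts G) - k"
  unfolding chromatic_number_def colorable_iff by (rule Least_equality) auto

text \<open>Enlarging the part of \<open>S\<close> in \<open>V1\<close> to \<open>j\<close> vertices
  and adding all of \<open>V2\<close> keeps \<open>j\<close>-colorability, so by maximality the
  result is \<open>S\<close>.\<close>

lemma card_maximal_colorable_ge:
  assumes S: "maximal_colorable G j S" and j: "k \<le> j" "j \<le> card (verts G) - k"
  shows "card S = k + j"
proof -
  define X where "X = S \<inter> V1"
  have S': "S \<subseteq> verts G" "colorable (G \<restriction> S) j" using S by (auto simp: maximal_colorable_def)
  have X: "X \<subseteq> V1" "S \<subseteq> X \<union> V2" using S'(1) partition(1) by (auto simp: X_def)
  have card_un: "card (Y \<union> V2) = card Y + k" if "Y \<subseteq> V1" for Y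
    using that partition(2) card_V2 finite_V1 finite_V2
    by (subst card_Un_disjoint) (auto intro: finite_subset)
  have max: "Y \<union> V2 = S" if "X \<subseteq> Y" "Y \<subseteq> V1" "k \<le> card Y" "card Y \<le> j" for Y
  proof (rule maximal_colorableD[OF S])
    show "S \<subseteq> Y \<union> V2" "Y \<union> V2 \<subseteq> verts G" using that X partition(1) by auto
    show "colorable (G \<restriction> (Y \<union> V2)) j"
      using colorable_with_V2[of Y] that colorable_mono by blast
  qed
  have "card X \<le> j"
    using clique_card_le[OF clique_in_subset[OF V1_clique X(1)], of S] S' by (simp add: X_def)
  moreover have "j \<le> card V1" using j(2) card_V1 by simp
  ultimately obtain Y where Y: "X \<subseteq> Y" "Y \<subseteq> V1" "card Y = j"
    using exists_subset_between[of X j V1] X(1) finite_V1 by blast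
  then show ?thesis
    using max[of Y] card_un[of Y] j(1) by simp
qed

lemma card_maximal_colorable_less:
  assumes S: "maximal_colorable G j S" and j: "j < k"
  shows "card S = 2 * j"
proof -
  define X where "X = S \<inter> V1"
  define T where "T = S \<inter> V2"
  have S': "S \<subseteq> verts G" "colorable (G \<restriction> S) j" using S by (auto simp: maximal_colorable_def)
  have XT: "X \<subseteq> V1" "T \<subseteq> V2" "S = X \<union> T" using S'(1) partition(1) by (auto simp: X_def T_def)
  have fin: "finite S" using S'(1) by (rule finite_subset_verts)
  have card_X: "card X \<le> j"
    using clique_card_le[OF clique_in_subset[OF V1_clique XT(1)], of S] S' by (simp add: X_def)
  obtain c where c: "c ` S \<subseteq> {..<j}"
    "\<And>u v. u \<in> S \<Longrightarrow> v \<in> S \<Longrightarrow> u \<noteq> v \<Longrightarrow> c u = c v \<Longrightarrow> nonadjacent G u v"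
    using S'(2) unfolding colorable_induce_iff by blast
  have inj_T: "inj_on c T"
    using c(2) XT clique_in_subset[OF V2_clique XT(2)] by (intro clique_inj_on_coloring) auto
  have "\<exists>x\<in>X. c x = c t" if t: "t \<in> T" for t
  proof (rule ccontr)
    assume no: "\<not> ?thesis"
    let ?N = "{x \<in> V1. \<not> nonadjacent G x t}"
    \<comment> \<open>Fewer than \<open>k\<close> vertices of \<open>V1\<close> are adjacent to
      \<open>t\<close> and at most \<open>j\<close> lie in \<open>X\<close>; since
      \<open>j < k\<close> and \<open>V1\<close> has at least 2k vertices, some vertex escapes both
      sets.\<close>
    have "card (?N \<union> X) < card V1"
      using card_Un_le[of ?N X] few_neighbors_in_V1[of t] t XT(2) card_X j card_V1 large
      by (auto simp: subset_iff)
    then have "?N \<union> X \<noteq> V1" by (metis less_irrefl)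
    then obtain x where x: "x \<in> V1" "x \<notin> X" "nonadjacent G x t" using XT(1) by blast
    have "x \<notin> S" using x by (simp add: X_def)
    have only_t: "v = t" if "v \<in> S" "c v = c t" for v
      using that no t inj_T XT(3) by (auto simp: inj_on_def)
    \<comment> \<open>The new vertex joins the class of \<open>t\<close>, which by
      \<open>only_t\<close> contains no other vertex of \<open>S\<close>.\<close>
    define d where "d = c(x := c t)"
    have "d ` insert x S \<subseteq> {..<j}"
      using c(1) t XT(3) by (auto simp: d_def)
    moreover have "nonadjacent G u v" if "u \<in> insert x S" "v \<in> insert x S" "u \<noteq> v" "d u = d v" for u v
    proof -
      consider "u = x" "v \<noteq> x" | "u \<noteq> x" "v = x" | "u \<noteq> x" "v \<noteq> x" using \<open>u \<noteq> v\<close> by blast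
      then show ?thesis
      proof cases
        case 1
        then show ?thesis using that only_t[of v] x(3) by (simp add: d_def)
      next
        case 2
        then show ?thesis using that only_t[of u] nonadjacent_sym[OF x(3)] by (simp add: d_def)
      next
        case 3
        then show ?thesis using that c(2)[of u v] by (simp add: d_def)
      qed
    qed
    ultimately have "colorable (G \<restriction> insert x S) j"
      unfolding colorable_induce_iff by blast
    moreover have "insert x S \<subseteq> verts G" using S'(1) x(1) partition(1) by blast
    ultimately show False
      using maximal_colorableD[OF S, of "insert x S"] \<open>x \<notin> S\<close> by blast
  qed
  then obtain M where M: "\<And>t. t \<in> T \<Longrightarrow> M t \<in> X" "\<And>t. t \<in> T \<Longrightarrow> c (M t) = c t" by metis
  have M_nonadj: "nonadjacent G (M t) t" if "t \<in> T" for t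
  proof (rule c(2))
    have "M t \<in> X" using that by (rule M(1))
    then show "M t \<in> S" "t \<in> S" using that XT(3) by simp_all
    have "M t \<in> V1" "t \<in> V2" using \<open>M t \<in> X\<close> that XT(1,2) by (meson subsetD)+
    then show "M t \<noteq> t" using partition(2) by (metis IntI empty_iff)
  qed (rule M(2)[OF that])
  have "inj_on M T"
    using M(2) inj_T unfolding inj_on_def by metis
  have "card X \<le> k" "k \<le> card V1" using card_X j card_V1 large by auto
  \<comment> \<open>\<open>X\<close> is padded to order \<open>k\<close> so that condition (2)
    applies; the matching is then restricted to \<open>X\<close>.\<close>
  then obtain Y where Y: "X \<subseteq> Y" "Y \<subseteq> V1" "card Y = k"
    using exists_subset_between[of X k V1] XT(1) finite_V1 by blast
  obtain N where N: "inj_on N Y" "N ` Y = V2" "\<And>x. x \<in> Y \<Longrightarrow> nonadjacent G x (N x)"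
    using ex_matching[OF Y(2,3)] by blast
  \<comment> \<open>\<open>N\<close> covers \<open>X\<close> and \<open>M\<close> covers
    \<open>T\<close>; the Mendelsohn--Dulmage lemma merges them into one matching that covers
    both.\<close>
  have "\<exists>f. inj_on f X \<and> T \<subseteq> f ` X \<and> f ` X \<subseteq> N ` X \<union> T \<and> (\<forall>x\<in>X. nonadjacent G x (f x))"
  proof (rule injection_covering_both_sides)
    show "finite T" using fin XT(3) by simp
    show "inj_on N X" using N(1) Y(1) by (rule inj_on_subset)
    show "M ` T \<subseteq> X" using M(1) by blast
  qed (use \<open>inj_on M T\<close> N(3) Y(1) M_nonadj in auto)
  then obtain f where f: "inj_on f X" "T \<subseteq> f ` X" "f ` X \<subseteq> V2" "\<And>x. x \<in> X \<Longrightarrow> nonadjacent G x (f x)"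
    using N(2) Y(1) XT(2) by blast
  have fX: "X \<union> f ` X \<subseteq> verts G" using XT(1) f(3) partition(1) by blast
  have disj: "X \<inter> f ` X = {}" using XT(1) f(3) partition(2) by blast
  have match: "comatching G W f X" if "X \<union> f ` X \<subseteq> W" for W
    using that f disj by (auto simp: comatching_def)
  have "finite X" using fin by (simp add: X_def)
  then have card_fX: "card (X \<union> f ` X) = 2 * card X"
    using disj f(1) by (simp add: card_Un_disjoint card_image)
  have "colorable (G \<restriction> (X \<union> f ` X)) j"
    using colorable_comatching[OF fX match] card_fX card_X colorable_mono by fastforce
  \<comment> \<open>The set of all matched vertices contains \<open>S\<close> and is
    \<open>j\<close>-colorable, so maximality identifies it with \<open>S\<close>.\<close>
  then have S_eq: "X \<union> f ` X = S"
    using maximal_colorableD[OF S _ fX] XT(3) f(2) by blast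
  have "card X = j"
  proof (rule ccontr)
    assume "card X \<noteq> j"
    then have "card X < j" using card_X by simp
    \<comment> \<open>A color is to spare, so any vertex outside \<open>S\<close> could be added;
      one exists because 2j < 3k.\<close>
    have "card S < card (verts G)"
      using card_fX[unfolded S_eq] card_X j large by linarith
    then obtain v where v: "v \<in> verts G" "v \<notin> S"
      using S'(1) by (metis less_irrefl subsetI subset_antisym)
    have "insert v S \<subseteq> verts G" using v S'(1) by blast
    moreover have "comatching G (insert v S) f X" using match S_eq by blast
    moreover have "card (insert v S) - card X \<le> j"
      using v(2) fin S_eq card_fX \<open>card X < j\<close> by simp
    ultimately have "colorable (G \<restriction> insert v S) j"
      using colorable_comatching colorable_mono by blast
    then show False
      using maximal_colorableD[OF S, of "insert v S"] v \<open>insert v S \<subseteq> verts G\<close> by blast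
  qed
  then show ?thesis using S_eq card_fX by simp
qed

text \<open>From the chromatic number on, the whole vertex set is the only maximal set.
  \<open>well_hued\<close> quantifies over these \<open>j\<close> too, although the sequence ends
  there.\<close>

lemma card_maximal_colorable_all:
  assumes "maximal_colorable G j S" "card (verts G) - k \<le> j"
  shows "card S = card (verts G)"
  using assms maximal_colorableD[of j S "verts G"] colorable_iff colorable_induce_verts
  by (auto simp: maximal_colorable_def)

lemma card_maximal_colorable:
  assumes "maximal_colorable G j S" "j \<le> card (verts G) - k"
  shows "card S = (if j \<le> k then 2 * j else k + j)"
  \<comment> \<open>The case \<open>j = k\<close> falls under the first lemma, where
    \<open>k + j\<close> is \<open>2 * j\<close>.\<close>
  using card_maximal_colorable_ge[OF assms(1)] card_maximal_colorable_less[OF assms(1)] assms(2)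
  by (cases "j < k") auto

lemma well_hued: "well_hued G"
  unfolding well_hued_def using card_maximal_colorable card_maximal_colorable_all
  by (metis nat_le_linear)

lemma hue_sequence_eq: "hue_sequence G = even_then_consecutive k (card (verts G))"
  unfolding hue_sequence_def even_then_consecutive_def chromatic_number_eq
  by (intro map_cong refl hue_order_eqI card_maximal_colorable) auto

end

section \<open>From the sequence to the clique structure\<close>

lemma comatching_iff:
  "comatching G S f A \<longleftrightarrow>
     A \<subseteq> S \<and> (\<forall>a\<in>A. f a \<in> S \<and> f a \<notin> A \<and> nonadjacent G a (f a)) \<and>
     (\<forall>a\<in>A. \<forall>b\<in>A. f a = f b \<longrightarrow> a = b)"
  unfolding comatching_def inj_on_def by blast

lemma comatching_subset: "comatching G S f A \<Longrightarrow> B \<subseteq> A \<Longrightarrow> comatching G S f B"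
  unfolding comatching_iff by blast

lemma comatching_insert:
  assumes "comatching G S f A" "{u, w} \<subseteq> S" "nonadjacent G u w"
    and "u \<notin> A" "w \<notin> A" "\<And>a. a \<in> A \<Longrightarrow> f a \<noteq> u" "\<And>a. a \<in> A \<Longrightarrow> f a \<noteq> w"
  shows "comatching G S (f(u := w)) (insert u A)"
proof -
  have "u \<noteq> w" using assms(3) by (simp add: nonadjacent_def)
  moreover have "(f(u := w)) a = f a" if "a \<in> A" for a using that assms(4) by auto
  ultimately show ?thesis
    using assms unfolding comatching_iff by auto
qed

context graph
begin

text \<open>The augmenting path is \<open>u\<close>, \<open>a\<close>, \<open>f a\<close>,
  \<open>w\<close>: the edge between \<open>a\<close> and \<open>f a\<close> gives way to the two
  outer ones. The domain grows by exactly one vertex, which makes the gain in size explicit.\<close>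

lemma comatching_augment_one:
  assumes m: "comatching G S f A" and uw: "{u, w} \<subseteq> S - (A \<union> f ` A)" "u \<noteq> w"
    and a: "a \<in> A" "nonadjacent G u a" "nonadjacent G w (f a)"
  shows "comatching G S (f(a := u, w := f a)) (insert w A)"
proof -
  have f: "f b \<in> S" "f b \<notin> A" "f b \<noteq> u" "f b \<noteq> w" "b \<noteq> u" "b \<noteq> w" "b \<in> S" if "b \<in> A" for b
    using that m uw(1) unfolding comatching_iff by blast+
  have inj: "f b \<noteq> f c" if "b \<in> A" "c \<in> A" "b \<noteq> c" for b c
    using that m unfolding comatching_iff by blast
  \<comment> \<open>The edge at \<open>a\<close> is dropped and \<open>a\<close> is put back with
    partner \<open>u\<close>; this frees \<open>f a\<close> for \<open>w\<close>.\<close>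
  have "comatching G S (f(a := u)) (insert a (A - {a}))"
  proof (rule comatching_insert[OF comatching_subset[OF m]])
    show "{a, u} \<subseteq> S" using uw(1) f(7)[OF a(1)] by blast
    show "nonadjacent G a u" using a(2) by (rule nonadjacent_sym)
    show "u \<notin> A - {a}" using uw(1) by blast
    show "f b \<noteq> a" if "b \<in> A - {a}" for b using f(2)[of b] that a(1) by auto
    show "f b \<noteq> u" if "b \<in> A - {a}" for b using f(3)[of b] that by simp
  qed auto
  then have "comatching G S (f(a := u)) A" using a(1) by (simp add: insert_absorb)
  then show ?thesis
  proof (rule comatching_insert)
    show "{w, f a} \<subseteq> S" using uw(1) f(1)[OF a(1)] by blast
    show "w \<notin> A" using uw(1) by blast
    show "f a \<notin> A" using a(1) by (rule f(2))
    show "(f(a := u)) b \<noteq> w" if "b \<in> A" for b using f(4)[OF that] uw(2) by simp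
    show "(f(a := u)) b \<noteq> f a" if "b \<in> A" for b
      using inj[OF that a(1)] f(3)[OF a(1)] by auto
  qed (rule a(3))
qed

text \<open>The augmenting path is \<open>u\<close>, \<open>a\<close>, \<open>f a\<close>,
  \<open>f b\<close>, \<open>b\<close>, \<open>w\<close>: the edges at \<open>a\<close> and
  \<open>b\<close> are rerouted to \<open>u\<close> and \<open>w\<close>, and the freed vertices
  \<open>f a\<close> and \<open>f b\<close> are joined.\<close>

lemma comatching_augment_two:
  assumes m: "comatching G S f A" and uw: "{u, w} \<subseteq> S - (A \<union> f ` A)" "u \<noteq> w"
    and ab: "a \<in> A" "b \<in> A" "a \<noteq> b"
    and nonadj: "nonadjacent G u a" "nonadjacent G w b" "nonadjacent G (f a) (f b)"
  shows "comatching G S (f(a := u, b := w, f a := f b)) (insert (f a) A)"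
proof -
  have f: "f c \<in> S" "f c \<notin> A" "f c \<noteq> u" "f c \<noteq> w" "c \<noteq> u" "c \<noteq> w" "c \<in> S" if "c \<in> A" for c
    using that m uw(1) unfolding comatching_iff by blast+
  have inj: "f c \<noteq> f d" if "c \<in> A" "d \<in> A" "c \<noteq> d" for c d
    using that m unfolding comatching_iff by blast
  have "comatching G S (f(a := u)) (insert a (A - {a, b}))"
  proof (rule comatching_insert[OF comatching_subset[OF m]])
    show "{a, u} \<subseteq> S" using uw(1) f(7)[OF ab(1)] by blast
    show "nonadjacent G a u" using nonadj(1) by (rule nonadjacent_sym)
    show "u \<notin> A - {a, b}" using uw(1) by blast
    show "f c \<noteq> a" if "c \<in> A - {a, b}" for c using f(2)[of c] that ab(1) by auto
    show "f c \<noteq> u" if "c \<in> A - {a, b}" for c using f(3)[of c] that by simp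
  qed auto
  then have "comatching G S (f(a := u, b := w)) (insert b (insert a (A - {a, b})))"
  proof (rule comatching_insert)
    show "{b, w} \<subseteq> S" using uw(1) f(7)[OF ab(2)] by blast
    show "nonadjacent G b w" using nonadj(2) by (rule nonadjacent_sym)
    show "b \<notin> insert a (A - {a, b})" using ab(3) by blast
    show "w \<notin> insert a (A - {a, b})" using uw(1) ab(1) by blast
    show "(f(a := u)) c \<noteq> b" if "c \<in> insert a (A - {a, b})" for c
      using f(2,5)[of c] f(5)[OF ab(2)] that ab by auto
    show "(f(a := u)) c \<noteq> w" if "c \<in> insert a (A - {a, b})" for c
      using f(4)[of c] that uw(2) by auto
  qed
  moreover have "insert b (insert a (A - {a, b})) = A" using ab by blast
  ultimately have "comatching G S (f(a := u, b := w)) A" by simp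
  then show ?thesis
  proof (rule comatching_insert)
    show "{f a, f b} \<subseteq> S" using f(1) ab by simp
    show "f a \<notin> A" "f b \<notin> A" using f(2) ab by blast+
    show "(f(a := u, b := w)) c \<noteq> f a" if "c \<in> A" for c
      using inj[OF that ab(1)] f(3,4)[OF ab(1)] by auto
    show "(f(a := u, b := w)) c \<noteq> f b" if "c \<in> A" for c
      using inj[OF that ab(2)] f(3,4)[OF ab(2)] by auto
  qed (rule nonadj(3))
qed

text \<open>The involution \<open>p\<close> swaps the ends of each edge, so that later arguments
  need not follow the orientation.\<close>

lemma comatching_partner:
  assumes "comatching G S f A"
  obtains p where "\<And>a. a \<in> A \<Longrightarrow> p a = f a" "\<And>a. a \<in> A \<Longrightarrow> p (f a) = a"
    "\<And>v. v \<in> A \<union> f ` A \<Longrightarrow> p v \<in> A \<union> f ` A" "\<And>v. v \<in> A \<union> f ` A \<Longrightarrow> p (p v) = v"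
    "\<And>v. v \<in> A \<union> f ` A \<Longrightarrow> nonadjacent G v (p v)"
proof -
  have m: "inj_on f A" "\<And>a. a \<in> A \<Longrightarrow> f a \<notin> A" "\<And>a. a \<in> A \<Longrightarrow> nonadjacent G a (f a)"
    using assms unfolding comatching_def by blast+
  define p where "p v = (if v \<in> A then f v else inv_into A f v)" for v
  have p: "p a = f a" "p (f a) = a" if "a \<in> A" for a
    using that m by (simp_all add: p_def)
  show ?thesis
  proof (rule that[of p])
    fix v assume "v \<in> A \<union> f ` A"
    then consider "v \<in> A" | a where "a \<in> A" "v = f a" by blast
    then show "p v \<in> A \<union> f ` A" "p (p v) = v" "nonadjacent G v (p v)"
      using p m(3) nonadjacent_sym by (cases; simp)+
  qed (use p in auto)
qed

end

section \<open>The structure forced by the sequence\<close>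

text \<open>Consequences of the sequence: \<open>triple_free\<close> comes from
  \<open>a\<^sub>1 = 2\<close>, \<open>card_maximal\<close> is \<open>a\<^sub>k = 2k\<close>, and
  \<open>colorable_iff\<close> expresses that the chromatic number is n - k.\<close>

locale hued = graph G for G :: "('a, 'b) pre_digraph" (structure) +
  fixes k :: nat
  assumes triple_free: "independent_triple_free G"
    and card_maximal: "\<And>S. maximal_colorable G k S \<Longrightarrow> card S = 2 * k"
    and colorable_iff: "\<And>j. colorable G j \<longleftrightarrow> card (verts G) - k \<le> j"
    and large: "3 * k \<le> card (verts G)"
begin

text \<open>A clique of order \<open>k\<close> lies in a maximal \<open>k\<close>-colorable set
  \<open>S\<close> of order 2k. A matching of the complement inside \<open>S\<close> with at least
  \<open>k\<close> edges covers \<open>S\<close>, and \<open>h\<close> takes partners in it.\<close>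

lemma clique_matching:
  assumes "clique_in G X" "card X = k"
  shows "\<exists>h. inj_on h X \<and> h ` X \<subseteq> verts G \<and> (\<forall>x\<in>X. nonadjacent G x (h x))"
proof -
  have "X \<subseteq> verts G" using assms(1) by (simp add: clique_in_def)
  then obtain S where S: "X \<subseteq> S" "maximal_colorable G k S"
    using extend_to_maximal_colorable[of X k] colorable_card[of X] assms(2) by auto
  have S': "S \<subseteq> verts G" "colorable (G \<restriction> S) k" using S(2) by (auto simp: maximal_colorable_def)
  have fin: "finite S" using S'(1) by (rule finite_subset_verts)
  obtain f A where m: "comatching G S f A" "card S \<le> card A + k"
    using comatching_of_colorable[OF triple_free S'] by blast
  have sub: "A \<union> f ` A \<subseteq> S" using m(1) by (simp add: comatching_def)
  have "finite A" using sub fin finite_subset by blast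
  then have "card (A \<union> f ` A) = 2 * card A"
    using m(1) by (simp add: comatching_def card_Un_disjoint card_image)
  then have "A \<union> f ` A = S"
    using card_mono[OF fin sub] m(2) card_maximal[OF S(2)] fin sub
    by (intro card_subset_eq) auto
  moreover obtain p where "\<And>v. v \<in> A \<union> f ` A \<Longrightarrow> p v \<in> A \<union> f ` A"
    "\<And>v. v \<in> A \<union> f ` A \<Longrightarrow> p (p v) = v" "\<And>v. v \<in> A \<union> f ` A \<Longrightarrow> nonadjacent G v (p v)"
    using m(1) by (rule comatching_partner) blast
  ultimately have p: "\<And>v. v \<in> S \<Longrightarrow> p v \<in> S" "\<And>v. v \<in> S \<Longrightarrow> p (p v) = v"
    "\<And>v. v \<in> S \<Longrightarrow> nonadjacent G v (p v)"
    by auto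
  have "inj_on p X"
    using p(2) S(1) by (metis inj_on_def subsetD)
  then show ?thesis
    using p(1,3) S(1) S'(1) by (intro exI[of _ p]) blast
qed

lemma card_comatching_le:
  assumes "comatching G (verts G) f A"
  shows "card A \<le> k"
proof -
  have "colorable G (card (verts G) - card A)"
    using colorable_comatching[OF subset_refl assms] by (simp add: colorable_induce_verts)
  \<comment> \<open>Counting both ends gives \<open>card A\<close> at most n, so the subtraction of
    natural numbers is not truncated.\<close>
  moreover have "finite A" "finite (f ` A)" "A \<union> f ` A \<subseteq> verts G" "card (A \<union> f ` A) = 2 * card A"
    using assms finite_subset_verts[of A] by (auto simp: comatching_def card_Un_disjoint card_image)
  then have "2 * card A \<le> card (verts G)" by (metis card_mono finite_verts)
  ultimately show ?thesis using large unfolding colorable_iff by linarith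
qed

lemma no_larger_comatching:
  assumes "comatching G (verts G) f A" "card A = k" "u \<notin> A"
  shows "\<not> comatching G (verts G) g (insert u A)"
proof
  assume "comatching G (verts G) g (insert u A)"
  then have "card (insert u A) \<le> k" by (rule card_comatching_le)
  moreover have "finite A" using assms(1) finite_subset_verts by (auto simp: comatching_def)
  ultimately show False using assms(2,3) by simp
qed

text \<open>A nonadjacent pair of uncovered vertices could be added as an edge to a maximum
  matching.\<close>

lemma unmatched_clique:
  assumes "comatching G (verts G) f A" "card A = k"
  shows "clique_in G (verts G - (A \<union> f ` A))"
proof -
  have "\<not> nonadjacent G u w"
    if uw: "u \<in> verts G - (A \<union> f ` A)" "w \<in> verts G - (A \<union> f ` A)" for u w
  proof
    assume "nonadjacent G u w"
    then have "comatching G (verts G) (f(u := w)) (insert u A)"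
      using uw by (intro comatching_insert[OF assms(1)]) auto
    then show False using no_larger_comatching[OF assms] uw(1) by blast
  qed
  then show ?thesis by (auto simp: clique_in_def)
qed

text \<open>\<open>P\<close> is covered by a maximum matching and \<open>U\<close> is the rest. A
  set \<open>W\<close> of \<open>k\<close> vertices of \<open>U\<close> is matched by
  \<open>h\<close>; its partners form \<open>V2\<close>, and \<open>V1\<close> is everything
  else.\<close>

lemma ex_clique_with_matchings:
  "\<exists>V1 V2. V1 \<union> V2 = verts G \<and> V1 \<inter> V2 = {} \<and> clique_in G V1 \<and> card V1 = card (verts G) - k \<and>
     card V2 = k \<and>
     (\<forall>X\<subseteq>V1. card X = k \<longrightarrow> (\<exists>h. inj_on h X \<and> h ` X = V2 \<and> (\<forall>x\<in>X. nonadjacent G x (h x))))"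
proof -
  have "colorable (G \<restriction> verts G) (card (verts G) - k)"
    by (simp add: colorable_induce_verts colorable_iff)
  then obtain f A where m: "comatching G (verts G) f A" "card (verts G) \<le> card A + (card (verts G) - k)"
    using comatching_of_colorable[OF triple_free subset_refl] by blast
  have card_A: "card A = k" using card_comatching_le[OF m(1)] m(2) large by linarith
  define P where "P = A \<union> f ` A"
  define U where "U = verts G - P"
  have P: "P \<subseteq> verts G" using m(1) by (simp add: P_def comatching_def)
  have "finite A" using P finite_subset_verts by (simp add: P_def)
  then have card_P: "card P = 2 * k"
    using m(1) card_A by (simp add: P_def comatching_def card_Un_disjoint card_image)
  have U_clique: "clique_in G U"
    using unmatched_clique[OF m(1) card_A] by (simp add: U_def P_def)
  obtain p where p_A: "\<And>a. a \<in> A \<Longrightarrow> p a = f a" "\<And>a. a \<in> A \<Longrightarrow> p (f a) = a"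
    and p: "\<And>v. v \<in> P \<Longrightarrow> p v \<in> P" "\<And>v. v \<in> P \<Longrightarrow> p (p v) = v" "\<And>v. v \<in> P \<Longrightarrow> nonadjacent G v (p v)"
    using m(1) unfolding P_def by (rule comatching_partner) blast
  \<comment> \<open>This excludes augmenting paths with a single matching edge; exchanging
    \<open>u\<close> and \<open>w\<close> accounts for its orientation.\<close>
  have one_sided: False if uw: "u \<in> U" "w \<in> U" "u \<noteq> w" and v: "v \<in> P" "nonadjacent G u v" "nonadjacent G w (p v)"
    for u w v
  proof -
    have aug: False if "a \<in> A" "nonadjacent G x a" "nonadjacent G y (f a)" "x \<in> U" "y \<in> U" "x \<noteq> y" for a x y
      using comatching_augment_one[OF m(1), of x y a] no_larger_comatching[OF m(1) card_A, of y] that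
      by (simp add: U_def P_def)
    consider "v \<in> A" | a where "a \<in> A" "v = f a" using v(1) by (auto simp: P_def)
    then show False
    proof cases
      case 1
      then show False using aug[of v u w] uw v p_A(1) by simp
    next
      case 2
      then show False using aug[of a w u] uw v p_A(2) by simp
    qed
  qed
  have "card U = card (verts G) - 2 * k"
    using P card_P finite_subset_verts[OF P] by (simp add: U_def card_Diff_subset)
  then have "k \<le> card U" using large by simp
  then obtain W where W: "W \<subseteq> U" "card W = k" "finite W"
    by (rule obtain_subset_with_card_n)
  obtain h where h: "inj_on h W" "h ` W \<subseteq> verts G" "\<And>w. w \<in> W \<Longrightarrow> nonadjacent G w (h w)"
    using clique_matching[OF clique_in_subset[OF U_clique W(1)] W(2)] by blast
  have h_P: "h w \<in> P" if "w \<in> W" for w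
  proof (rule ccontr)
    assume "h w \<notin> P"
    then have "h w \<in> U" "w \<in> U" using that h(2) W(1) by (auto simp: U_def)
    then show False using h(3)[OF that] U_clique by (simp add: clique_in_def)
  qed
  define V2 where "V2 = h ` W"
  define V1 where "V1 = verts G - V2"
  have V2_P: "V2 \<subseteq> P" using h_P by (auto simp: V2_def)
  have card_V2: "card V2 = k" using h(1) W(2) by (simp add: V2_def card_image)
  \<comment> \<open>If both ends of a matching edge were in \<open>V2\<close>, their partners in
    \<open>W\<close> would be the ends of an augmenting path.\<close>
  have disj: "p v \<notin> V2" if v: "v \<in> V2" for v
  proof
    assume "p v \<in> V2"
    then obtain w w' where w: "w \<in> W" "w' \<in> W" "v = h w" "p v = h w'"
      using v unfolding V2_def by blast
    have "v \<in> P" using V2_P v by blast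
    then have "p v \<noteq> v" using p(3)[of v] by (auto simp: nonadjacent_def)
    then have "w \<noteq> w'" using w by auto
    then show False
      using one_sided[of w w' v] w W(1) h(3)[of w] h(3)[of w'] \<open>v \<in> P\<close> by auto
  qed
  have p_inj: "v = v'" if "v \<in> P" "v' \<in> P" "p v = p v'" for v v'
    using that p(2) by metis
  \<comment> \<open>The same matching is reoriented so that every edge starts in \<open>V2\<close>;
    by counting, each edge of \<open>P\<close> has exactly one end there.\<close>
  have m2: "comatching G (verts G) p V2"
    unfolding comatching_iff
  proof (intro conjI ballI impI)
    show "V2 \<subseteq> verts G" using V2_P P by blast
    fix v assume "v \<in> V2"
    then have "v \<in> P" using V2_P by blast
    then show "p v \<in> verts G" "nonadjacent G v (p v)" using p(1,3) P by auto
    show "p v \<notin> V2" using \<open>v \<in> V2\<close> by (rule disj)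
    show "v = v'" if "v' \<in> V2" "p v = p v'" for v'
      using that \<open>v \<in> P\<close> V2_P p_inj by blast
  qed
  have P_eq: "V2 \<union> p ` V2 = P"
  proof (rule card_subset_eq)
    show "finite P" using P by (rule finite_subset_verts)
    show "V2 \<union> p ` V2 \<subseteq> P" using V2_P p(1) by blast
    have "finite V2" using W(3) by (simp add: V2_def)
    then show "card (V2 \<union> p ` V2) = card P"
      using m2 card_V2 card_P by (simp add: comatching_def card_Un_disjoint card_image)
  qed
  have U_eq: "U = verts G - (V2 \<union> p ` V2)" by (simp add: U_def P_eq)
  \<comment> \<open>With \<open>w\<close> the partner of \<open>v\<close> in \<open>W\<close>: if
    \<open>w = y\<close>, then \<open>y\<close>, \<open>v\<close>, \<open>p v\<close> is an
    independent triple; otherwise \<open>w\<close>, \<open>v\<close>, \<open>p v\<close>,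
    \<open>y\<close> is an augmenting path.\<close>
  have mixed: False if y: "y \<in> U" "v \<in> V2" "nonadjacent G y (p v)" for y v
  proof -
    obtain w where w: "w \<in> W" "v = h w" using y(2) by (auto simp: V2_def)
    show False
    proof (cases "w = y")
      case True
      then have "nonadjacent G y v" using h(3) w by simp
      moreover have "v \<in> P" using y(2) V2_P by blast
      then have "nonadjacent G v (p v)" "p v \<in> verts G" "v \<in> verts G" using p P by auto
      moreover have "y \<in> verts G" using y(1) by (simp add: U_def)
      ultimately show False
        using y(3) triple_free unfolding independent_triple_free_def by blast
    next
      case False
      then show False
        using one_sided[of w y v] w W(1) y h(3)[of w] V2_P by blast
    qed
  qed
  \<comment> \<open>The path \<open>w\<close>, \<open>v\<close>, \<open>p v\<close>,
    \<open>p v'\<close>, \<open>v'\<close>, \<open>w'\<close> would be augmenting.\<close>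
  have both: False if v: "v \<in> V2" "v' \<in> V2" "nonadjacent G (p v) (p v')" for v v'
  proof -
    obtain w w' where w: "w \<in> W" "w' \<in> W" "v = h w" "v' = h w'" using v(1,2) by (auto simp: V2_def)
    have "v \<noteq> v'" using v(3) by (auto simp: nonadjacent_def)
    then have "comatching G (verts G) (p(v := w, v' := w', p v := p v')) (insert (p v) V2)"
      using w W(1) h(3) v U_eq by (intro comatching_augment_two[OF m2]) auto
    then show False
      using no_larger_comatching[OF m2 card_V2] disj[OF v(1)] by blast
  qed
  have V1_cases: "y \<in> U \<or> (\<exists>v\<in>V2. y = p v)" if "y \<in> V1" for y
    using that U_eq by (auto simp: V1_def)
  have "\<not> nonadjacent G y z" if yz: "y \<in> V1" "z \<in> V1" for y z
  proof
    assume "nonadjacent G y z"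
    moreover from this have "nonadjacent G z y" by (rule nonadjacent_sym)
    ultimately show False
      using V1_cases[OF yz(1)] V1_cases[OF yz(2)] U_clique mixed both
      unfolding clique_in_def by metis
  qed
  then have V1_clique: "clique_in G V1" by (auto simp: clique_in_def V1_def)
  have V2_verts: "V2 \<subseteq> verts G" using V2_P P by blast
  \<comment> \<open>Partners of a subset of the clique \<open>V1\<close> lie outside it, hence in
    \<open>V2\<close>, and \<open>k\<close> distinct ones fill \<open>V2\<close>.\<close>
  have "\<exists>h. inj_on h X \<and> h ` X = V2 \<and> (\<forall>x\<in>X. nonadjacent G x (h x))"
    if X: "X \<subseteq> V1" "card X = k" for X
  proof -
    obtain g where g: "inj_on g X" "g ` X \<subseteq> verts G" "\<And>x. x \<in> X \<Longrightarrow> nonadjacent G x (g x)"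
      using clique_matching[OF clique_in_subset[OF V1_clique X(1)] X(2)] by blast
    have "g x \<in> V2" if "x \<in> X" for x
    proof (rule ccontr)
      assume "g x \<notin> V2"
      then have "g x \<in> V1" using that g(2) by (auto simp: V1_def)
      then show False using g(3)[OF that] that X(1) V1_clique by (auto simp: clique_in_def)
    qed
    then have "g ` X = V2"
      using X(2) g(1) card_V2 finite_subset_verts[OF V2_verts]
      by (intro card_subset_eq) (auto simp: card_image)
    then show ?thesis using g by blast
  qed
  moreover have "card V1 = card (verts G) - k"
    using V2_verts card_V2 finite_subset_verts by (simp add: V1_def card_Diff_subset)
  moreover have "V1 \<union> V2 = verts G" "V1 \<inter> V2 = {}" using V2_verts by (auto simp: V1_def)
  ultimately show ?thesis using V1_clique card_V2 by blast
qed

end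

section \<open>Reading the sequence, and the equivalence\<close>

lemma (in graph) hued_of_sequence:
  assumes "well_hued G" "hue_sequence G = even_then_consecutive k (card (verts G))"
    and "1 \<le> k" "3 * k \<le> card (verts G)"
  shows "hued G k"
proof -
  let ?n = "card (verts G)"
  \<comment> \<open>Comparing lengths gives the chromatic number, since the prescribed list has n -
    k entries.\<close>
  have "length (hue_sequence G) = length (even_then_consecutive k ?n)"
    using assms(2) by simp
  then have chi: "chromatic_number G = ?n - k"
    by (simp add: hue_sequence_def even_then_consecutive_def del: upt_Suc)
  have "colorable G ?n"
    using colorable_card[OF subset_refl] by (simp add: colorable_induce_verts)
  then have "colorable G (?n - k)"
    unfolding chi[symmetric] chromatic_number_def by (rule LeastI)
  then have colorable_iff: "colorable G j \<longleftrightarrow> ?n - k \<le> j" for j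
    using colorable_mono Least_le[of "colorable G" j] chi unfolding chromatic_number_def by metis
  have hue: "hue_order G i = (if i \<le> k then 2 * i else k + i)" if "1 \<le> i" "i \<le> ?n - k" for i
  proof -
    have "\<forall>i\<in>set [1..<?n - k + 1]. hue_order G i = (if i \<le> k then 2 * i else k + i)"
      using assms(2) unfolding hue_sequence_def even_then_consecutive_def chi map_eq_conv .
    moreover have "i \<in> set [1..<?n - k + 1]" using that by (simp del: upt_Suc)
    ultimately show ?thesis by blast
  qed
  have card_max: "card S = 2 * i" if "maximal_colorable G i S" "1 \<le> i" "i \<le> k" for i S
  proof -
    have "hue_order G i = card S"
      using assms(1) that(1,2) unfolding well_hued_def by (intro hue_order_eqI) blast
    moreover have "i \<le> ?n - k" using that(3) assms(4) by simp
    ultimately show ?thesis using hue[of i] that(2,3) by simp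
  qed
  have "independent_triple_free G"
    unfolding independent_triple_free_def
  proof (intro ballI notI)
    fix x y z assume xyz: "x \<in> verts G" "y \<in> verts G" "z \<in> verts G"
      and nonadj: "nonadjacent G x y \<and> nonadjacent G y z \<and> nonadjacent G x z"
    have "nonadjacent G u v" if "u \<in> {x, y, z}" "v \<in> {x, y, z}" "u \<noteq> v" for u v
      using that nonadj nonadjacent_sym by blast
    \<comment> \<open>An independent triple is 1-colorable, so it would lie in a maximal set whose
      order is only 2.\<close>
    then have "colorable (G \<restriction> {x, y, z}) 1"
      unfolding colorable_induce_iff by (intro exI[of _ "\<lambda>_. 0"]) auto
    then obtain S where S: "{x, y, z} \<subseteq> S" "maximal_colorable G 1 S"
      using extend_to_maximal_colorable[of "{x, y, z}" 1] xyz by auto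
    then have "card {x, y, z} \<le> card S"
      using finite_subset_verts[of S] by (intro card_mono) (auto simp: maximal_colorable_def)
    moreover have "card S = 2" using card_max[OF S(2)] assms(3) by simp
    moreover have "card {x, y, z} = 3" using nonadj by (simp add: nonadjacent_def)
    ultimately show False by simp
  qed
  then show ?thesis
    using card_max[of k] colorable_iff assms(3,4) by unfold_locales auto
qed

theorem theorem6:
  fixes G :: "('a, 'b) pre_digraph" and k :: nat
  assumes "graph G"
    and "k \<ge> 2"
    and "card (verts G) \<ge> 3 * k"
  shows "(Digraph_Component.connected G \<and> well_hued G \<and>
          hue_sequence G = even_then_consecutive k (card (verts G)))
     \<longleftrightarrow>
         (Digraph_Component.connected G \<and>
          (\<exists>V1 V2. V1 \<union> V2 = verts G \<and> V1 \<inter> V2 = {} \<and>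
             complete_digraph (card (verts G) - k) (G \<restriction> V1) \<and>
             card V2 = k \<and>
             (\<forall>u\<in>verts G. is_clique (G \<restriction> (verts G - closed_neighborhood G u))) \<and>
             (\<forall>X\<subseteq>V1. card X = k \<longrightarrow>
                (\<exists>M. matching_between (graph_complement G) X V2 M \<and> card M = k))))"
proof -
  interpret graph G by (rule assms(1))
  let ?n = "card (verts G)"
  let ?matched = "\<lambda>V1 V2. \<forall>X\<subseteq>V1. card X = k \<longrightarrow>
    (\<exists>f. inj_on f X \<and> f ` X = V2 \<and> (\<forall>x\<in>X. nonadjacent G x (f x)))"
  have structure_iff: "(V1 \<union> V2 = verts G \<and> V1 \<inter> V2 = {} \<and>
      complete_digraph (?n - k) (G \<restriction> V1) \<and> card V2 = k \<and>
      (\<forall>u\<in>verts G. is_clique (G \<restriction> (verts G - closed_neighborhood G u))) \<and>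
      (\<forall>X\<subseteq>V1. card X = k \<longrightarrow>
        (\<exists>M. matching_between (graph_complement G) X V2 M \<and> card M = k))) \<longleftrightarrow>
    V1 \<union> V2 = verts G \<and> V1 \<inter> V2 = {} \<and> clique_in G V1 \<and> card V1 = ?n - k \<and> card V2 = k \<and>
      independent_triple_free G \<and> ?matched V1 V2" (is "?L \<longleftrightarrow> ?R") for V1 V2
  \<comment> \<open>The translations of cliques and matchings need a partition with parts of the
    right order; without it both sides fail.\<close>
  proof (cases "V1 \<union> V2 = verts G \<and> V1 \<inter> V2 = {} \<and> card V2 = k")
    case True
    then have V: "V1 \<subseteq> verts G" "V2 \<subseteq> verts G" "card V2 = k" "V1 \<inter> V2 = {}" by auto
    have "(\<exists>M. matching_between (graph_complement G) X V2 M \<and> card M = k) \<longleftrightarrow>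
        (\<exists>f. inj_on f X \<and> f ` X = V2 \<and> (\<forall>x\<in>X. nonadjacent G x (f x)))"
      if "X \<subseteq> V1" "card X = k" for X
    proof (rule matching_between_complement_iff)
      show "X \<inter> V2 = {}" "X \<subseteq> verts G" using that(1) V(1,4) by blast+
    qed (use V that(2) in auto)
    then have "(\<forall>X\<subseteq>V1. card X = k \<longrightarrow>
        (\<exists>M. matching_between (graph_complement G) X V2 M \<and> card M = k)) \<longleftrightarrow> ?matched V1 V2"
      by (metis (no_types, lifting))
    then show ?thesis
      unfolding nonneighbors_cliques_iff complete_induce_iff[OF V(1)] by argo
  next
    case False
    then show ?thesis by argo
  qed
  have "(well_hued G \<and> hue_sequence G = even_then_consecutive k ?n) \<longleftrightarrow>
    (\<exists>V1 V2. V1 \<union> V2 = verts G \<and> V1 \<inter> V2 = {} \<and> clique_in G V1 \<and> card V1 = ?n - k \<and> card V2 = k \<and>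
      independent_triple_free G \<and> ?matched V1 V2)" (is "?hued \<longleftrightarrow> ?struct")
  proof
    assume ?hued
    then interpret hued G k
      using hued_of_sequence assms(2,3) by simp
    show ?struct using ex_clique_with_matchings triple_free by blast
  next
    assume ?struct
    then obtain V1 V2 where "V1 \<union> V2 = verts G" "V1 \<inter> V2 = {}" "clique_in G V1" "card V2 = k"
      "independent_triple_free G" "?matched V1 V2" by blast
    then interpret matched_cliques G V1 V2 k
      using assms(2,3) by unfold_locales auto
    show ?hued using well_hued hue_sequence_eq by blast
  qed
  then show ?thesis unfolding structure_iff by blast
qed

end
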